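(* Let $\mu$ be a probability measure on $(E,\mathcal{B})$. Then $\mu$ satisfies the $L^1$-transportation cost-information inequality on $(E,d)$ with some constant $C$ (that is, $\mu\in T_1(C)$ for some $C$) if and only if there is some $\delta>0$ such that $$\iint e^{\delta\, d^2(x,y)}\,d\mu(x)\,d\mu(y)<+\infty .$$ In the latter case (i.e. when this holds for a given $\delta>0$), $\mu\in T_1(C)$ for a constant $C$ satisfying $$C\le \frac{2}{\delta}\sup_{k\ge 1}\left(\frac{(k!)^2}{(2k)!}\right)^{1/k}\cdot\left[\iint e^{\delta\, d^2(x,y)}\,d\mu(x)\,d\mu(y)\right]^{1/k}<+\infty .$$
   Context: $(E,d)$ is a metric space equipped with a $\sigma$-field $\mathcal{B}$ such that $d(\cdot,\cdot)$ is $\mathcal{B}\times\mathcal{B}$-measurable; when $(E,d)$ is separable, $\mathcal{B}$ is the Borel $\sigma$-field. For $p\ge 1$ and probability measures $\mu,\nu$ on $E$, $$W_p^d(\mu,\nu)=\inf_\pi\left(\iint d(x,y)^p\,d\pi(x,y)\right)^{1/p},$$ the infimum being over all probability measures $\pi$ on $E\times E$ with marginals $\mu$ and $\nu$. The relative entropy is $H(\nu/\mu)=\int\log\frac{d\nu}{d\mu}\,d\nu$ if $\nu\ll\mu$ and $+\infty$ otherwise. One writes $\mu\in T_p(C)$ if $W_p^d(\mu,\nu)\le\sqrt{2C\,H(\nu/\mu)}$ for every probability measure $\nu$ on $E$ (the inequality is trivially true when $H(\nu/\mu)=+\infty$). *)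

theory Defs
  imports "HOL-Probability.Probability"
begin

text \<open>
  A measurable space \<open>(E, \<B>)\<close> is carried by the measures on it, as \<^term>\<open>space \<mu>\<close> and
  \<^term>\<open>sets \<mu>\<close>.  Couplings are probability measures on the product sigma-algebra; in the
  non-separable case this may differ from the Borel sigma-algebra of the product.
\<close>

definition couplings :: "'a measure \<Rightarrow> 'a measure \<Rightarrow> ('a \<times> 'a) measure set" where
  "couplings \<mu> \<nu> = {\<pi>. prob_space \<pi> \<and> sets \<pi> = sets (\<mu> \<Otimes>\<^sub>M \<nu>) \<and>
                       distr \<pi> \<mu> fst = \<mu> \<and> distr \<pi> \<nu> snd = \<nu>}"

text \<open>Real powers of extended nonnegative reals, used for exponents \<open>a > 0\<close> only.\<close>

definition ennreal_powr :: "ennreal \<Rightarrow> real \<Rightarrow> ennreal" where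
  "ennreal_powr x a = (if x = \<infinity> then \<infinity> else ennreal (enn2real x powr a))"

definition wasserstein ::
  "real \<Rightarrow> ('a \<Rightarrow> 'a \<Rightarrow> real) \<Rightarrow> 'a measure \<Rightarrow> 'a measure \<Rightarrow> ennreal" where
  "wasserstein p d \<mu> \<nu> =
     (INF \<pi>\<in>couplings \<mu> \<nu>.
        ennreal_powr (\<integral>\<^sup>+ (x, y). ennreal (d x y powr p) \<partial>\<pi>) (1 / p))"

text \<open>
  The relative entropy \<open>H(\<nu>/\<mu>)\<close>.  The negative part of \<open>log (d\<nu>/d\<mu>)\<close> is always \<open>\<nu>\<close>-integrable for
  probability measures with \<open>\<nu> \<lless> \<mu>\<close>, so the integral exists in \<open>(-\<infinity>, \<infinity>]\<close> and equals \<open>\<infinity>\<close> exactly when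
  the integrand is not integrable.  The Bochner integral in \<^const>\<open>KL_divergence\<close> would be \<open>0\<close> in
  that case.
\<close>

definition relative_entropy :: "'a measure \<Rightarrow> 'a measure \<Rightarrow> ereal" where
  "relative_entropy \<nu> \<mu> =
     (if absolutely_continuous \<mu> \<nu> \<and> integrable \<nu> (entropy_density (exp 1) \<mu> \<nu>)
      then ereal (KL_divergence (exp 1) \<mu> \<nu>) else \<infinity>)"

text \<open>
  \<open>\<mu> \<in> T\<^sub>p(C)\<close>, for a constant \<open>C \<ge> 0\<close>.  The inequality is void when \<open>H(\<nu>/\<mu>) = \<infinity>\<close>, also for \<open>C = 0\<close>.
\<close>

definition transport_inequality ::
  "real \<Rightarrow> ('a \<Rightarrow> 'a \<Rightarrow> real) \<Rightarrow> real \<Rightarrow> 'a measure \<Rightarrow> bool" where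
  "transport_inequality p d C \<mu> \<longleftrightarrow> 0 \<le> C \<and>
     (\<forall>\<nu>. prob_space \<nu> \<and> sets \<nu> = sets \<mu> \<and> relative_entropy \<nu> \<mu> < \<infinity> \<longrightarrow>
        wasserstein p d \<mu> \<nu> \<le> ennreal (sqrt (2 * C * real_of_ereal (relative_entropy \<nu> \<mu>))))"

definition gauss_moment :: "('a \<Rightarrow> 'a \<Rightarrow> real) \<Rightarrow> 'a measure \<Rightarrow> real \<Rightarrow> ennreal" where
  "gauss_moment d \<mu> \<delta> = (\<integral>\<^sup>+ y. \<integral>\<^sup>+ x. ennreal (exp (\<delta> * (d x y)\<^sup>2)) \<partial>\<mu> \<partial>\<mu>)"

text \<open>Both factors depend on \<open>k\<close>, so the supremum is taken over their product.\<close>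

definition T1_bound :: "('a \<Rightarrow> 'a \<Rightarrow> real) \<Rightarrow> 'a measure \<Rightarrow> real \<Rightarrow> ennreal" where
  "T1_bound d \<mu> \<delta> = ennreal (2 / \<delta>) *
     (SUP k\<in>{1::nat..}. ennreal (((fact k)\<^sup>2 / fact (2 * k)) powr (1 / real k)) *
                         ennreal_powr (gauss_moment d \<mu> \<delta>) (1 / real k))"

end

theory Submission
  imports Defs
begin

text \<open>
  Since \<open>(k!)\<^sup>2 / (2k)!\<close> equals \<open>1 / 2\<close> for \<open>k = 1\<close>, the bound is at least \<open>G / \<delta>\<close>, where \<open>G\<close> is the
  Gaussian moment, so it suffices to prove \<open>T\<^sub>1(G / \<delta>)\<close>.  For \<open>\<nu> = f \<mu>\<close>, the coupling that leaves the
  common mass of \<open>\<mu>\<close> and \<open>\<nu>\<close> in place gives \<open>W \<le> \<integral> d(x, y) |f(x) - 1| d\<mu>(x)\<close> for every base point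
  \<open>y\<close>.  The weighted Pinsker inequality of Bolley and Villani bounds the square of the right-hand
  side by \<open>(2 / \<delta>) H(\<nu>/\<mu>) \<integral> exp (\<delta> d(x, y)\<^sup>2) d\<mu>(x)\<close>, and integration over \<open>y\<close> yields \<open>G\<close>.  No
  Kantorovich duality is needed.

  Conversely, let \<open>\<nu>\<close> be \<open>\<mu>\<close> conditioned on \<open>B = {d(x\<^sub>0, \<cdot>) \<ge> R}\<close>, so that \<open>H(\<nu>/\<mu>) = - log \<mu>(B)\<close>.
  A coupling of \<open>\<mu>\<close> and \<open>\<nu>\<close> moves a ball of radius \<open>m\<close> and mass at least \<open>1 / 2\<close> into \<open>B\<close>, at cost at
  least \<open>(R - m) / 2\<close>.  This bounds the tail of \<open>d(x\<^sub>0, \<cdot>)\<close> by a Gaussian.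
\<close>

section \<open>Pointwise inequalities and the weighted Pinsker inequality\<close>

text \<open>The difference of the two sides, divided by \<open>4 + 2 * t\<close>, is a function
  \<open>g\<close> that vanishes at \<open>1\<close> together with its derivative and is convex on
  the positive reals, so \<open>1\<close> is its minimum. At \<open>t = 0\<close> the claim reads
  \<open>3 \<le> 4\<close>.\<close>

lemma pinsker_pointwise:
  fixes t :: real
  assumes "0 \<le> t"
  shows "3 * (t - 1)\<^sup>2 \<le> (4 + 2 * t) * (t * ln t - t + 1)"
proof (cases "t = 0")
  case False
  with assms have t: "0 < t" by simp
  \<comment> \<open>\<open>g'\<close> is the derivative of \<open>g\<close>: with
    \<open>u = s + 2\<close>, the quotient subtracted in \<open>g\<close> is
    \<open>3/2 * (u - 6 + 9 / u)\<close>, which explains the constants.\<close>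
  define g' where "g' = (\<lambda>s::real. ln s - 3/2 + 27 / (2 * (s + 2)\<^sup>2))"
  define g where "g = (\<lambda>s::real. s * ln s - s + 1 - 3 * (s - 1)\<^sup>2 / (4 + 2 * s))"
  have dg': "(g' has_real_derivative (1 / s - 27 / (s + 2) ^ 3)) (at s)" if "0 < s" for s
  proof -
    define u where "u = s + 2"
    have u: "u \<noteq> 0" using that by (simp add: u_def)
    have "(g' has_real_derivative (1 / s + (- (27 * (2 * (2 * u)))) / (2 * u\<^sup>2)\<^sup>2)) (at s)"
      unfolding g'_def u_def using that
      by (auto intro!: derivative_eq_intros simp: power2_eq_square add_eq_0_iff)
    moreover have "(- (27 * (2 * (2 * u)))) / (2 * u\<^sup>2)\<^sup>2 = - 27 / u ^ 3"
      using u by (simp add: field_simps power2_eq_square power3_eq_cube)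
    ultimately show ?thesis by (simp add: u_def)
  qed
  have dg: "(g has_real_derivative g' s) (at s)" if "0 < s" for s
  proof -
    define u where "u = s + 2"
    have u: "u \<noteq> 0" and s: "s = u - 2" using that by (simp_all add: u_def)
    have "(g has_real_derivative
        (ln s - (3 * (2 * (s - 1)) * (4 + 2 * s) - 3 * (s - 1)\<^sup>2 * 2) / (4 + 2 * s)\<^sup>2)) (at s)"
      unfolding g_def using that
      by (auto intro!: derivative_eq_intros simp: power2_eq_square add_eq_0_iff)
    moreover have "(3 * (2 * (s - 1)) * (4 + 2 * s) - 3 * (s - 1)\<^sup>2 * 2) / (4 + 2 * s)\<^sup>2
        = 3/2 - 27 / (2 * u\<^sup>2)"
      using u unfolding s by (simp add: field_simps power2_eq_square)
    hence "ln s - (3 * (2 * (s - 1)) * (4 + 2 * s) - 3 * (s - 1)\<^sup>2 * 2) / (4 + 2 * s)\<^sup>2 = g' s"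
      by (simp add: g'_def u_def)
    ultimately show ?thesis by simp
  qed
  have nn: "0 \<le> 1 / s - 27 / (s + 2) ^ 3" if "0 < s" for s :: real
  proof -
    \<comment> \<open>This is the AM-GM inequality for \<open>s, 1, 1\<close>; equality at
      \<open>s = 1\<close> accounts for the double root.\<close>
    have "(s + 2) ^ 3 - 27 * s = (s - 1)\<^sup>2 * (s + 8)"
      by (simp add: power2_eq_square power3_eq_cube algebra_simps)
    moreover have "0 \<le> (s - 1)\<^sup>2 * (s + 8)" using that by simp
    ultimately have "27 * s \<le> (s + 2) ^ 3" by linarith
    thus ?thesis using that by (simp add: field_simps)
  qed
  have g'_mono: "g' a \<le> g' b" if "0 < a" "a \<le> b" for a b
  proof (rule DERIV_nonneg_imp_nondecreasing[where f = g', OF that(2)])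
    fix x assume "a \<le> x" "x \<le> b"
    with that(1) have "0 < x" by simp
    from dg'[OF this] nn[OF this] show "\<exists>y. (g' has_real_derivative y) (at x) \<and> 0 \<le> y" by blast
  qed
  have g'1: "g' 1 = 0" and g1: "g 1 = 0" by (simp_all add: g'_def g_def)
  have "0 \<le> g t"
  proof (cases "1 \<le> t")
    case True
    have "g 1 \<le> g t"
    proof (rule DERIV_nonneg_imp_nondecreasing[where f = g, OF True])
      fix x :: real assume x: "1 \<le> x" "x \<le> t"
      have "0 \<le> g' x" using g'_mono[of 1 x] g'1 x by simp
      moreover have "(g has_real_derivative g' x) (at x)" using dg[of x] x by simp
      ultimately show "\<exists>y. (g has_real_derivative y) (at x) \<and> 0 \<le> y" by blast
    qed
    thus ?thesis using g1 by simp
  next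
    case False
    have "g 1 \<le> g t"
    proof (rule DERIV_nonpos_imp_nonincreasing[where f = g])
      show "t \<le> 1" using False by simp
      fix x :: real assume x: "t \<le> x" "x \<le> 1"
      have "g' x \<le> 0" using g'_mono[of x 1] g'1 x t by simp
      moreover have "(g has_real_derivative g' x) (at x)" using dg[of x] x t by simp
      ultimately show "\<exists>y. (g has_real_derivative y) (at x) \<and> y \<le> 0" by blast
    qed
    thus ?thesis using g1 by simp
  qed
  thus ?thesis using t by (simp add: g_def field_simps)
qed simp

text \<open>Young's inequality for the convex conjugates \<open>t * ln t - t\<close> and
  \<open>exp\<close>. It is \<open>1 + z \<le> exp z\<close> at \<open>z = a - ln t\<close>,
  multiplied by \<open>t\<close>.\<close>

lemma young_exp:
  fixes a t :: real
  assumes "0 \<le> t"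
  shows "a * t \<le> t * ln t - t + exp a"
proof (cases "t = 0")
  case False
  with assms have t: "0 < t" by simp
  have "t * (1 + (a - ln t)) \<le> t * exp (a - ln t)"
    using t by (intro mult_left_mono exp_ge_add_one_self) auto
  thus ?thesis using t by (simp add: exp_diff algebra_simps)
qed simp

text \<open>Two bounds on the squared integral are combined. Cauchy-Schwarz with
  \<open>pinsker_pointwise\<close> yields a factor \<open>H\<close> and is good for small entropy;
  the crude \<open>|f - 1| \<le> f + 1\<close> is good for large entropy. Both involve only the
  integrals \<open>P\<close> of \<open>\<phi>^2\<close> and \<open>Q\<close> of
  \<open>\<phi>^2 * f\<close>, which \<open>sq_le\<close> and \<open>young\<close> control by
  \<open>G\<close> and \<open>H\<close>.\<close>

lemma (in prob_space) weighted_pinsker: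
  fixes f \<phi> :: "'a \<Rightarrow> real"
  assumes [measurable]: "f \<in> borel_measurable M" "\<phi> \<in> borel_measurable M"
    and f_nn: "\<And>x. 0 \<le> f x" and \<phi>_nn: "\<And>x. x \<in> space M \<Longrightarrow> 0 \<le> \<phi> x"
    and f_int: "integrable M f" "(\<integral>x. f x \<partial>M) = 1"
    and H_int: "integrable M (\<lambda>x. f x * ln (f x))"
    and G_int: "integrable M (\<lambda>x. exp ((\<phi> x)\<^sup>2))"
  shows "integrable M (\<lambda>x. \<phi> x * \<bar>f x - 1\<bar>)"
    and "(\<integral>x. \<phi> x * \<bar>f x - 1\<bar> \<partial>M)\<^sup>2 \<le> 2 * (\<integral>x. f x * ln (f x) \<partial>M) * (\<integral>x. exp ((\<phi> x)\<^sup>2) \<partial>M)"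
proof -
  \<comment> \<open>Adding \<open>1 - f\<close>, whose integral is \<open>0\<close>, makes the
    entropy integrand nonnegative and keeps its integral.\<close>
  define h where "h = (\<lambda>x. f x * ln (f x) - f x + 1)"
  define H where "H = (\<integral>x. f x * ln (f x) \<partial>M)"
  define G where "G = (\<integral>x. exp ((\<phi> x)\<^sup>2) \<partial>M)"
  \<comment> \<open>Chosen such that \<open>\<phi> |f - 1| \<le> sqrt K sqrt h\<close>.\<close>
  define K where "K = (\<lambda>x. (\<phi> x)\<^sup>2 * (4 + 2 * f x) / 3)"
  have [measurable]: "h \<in> borel_measurable M" "K \<in> borel_measurable M"
    by (simp_all add: h_def K_def)
  have young: "(\<phi> x)\<^sup>2 * f x \<le> f x * ln (f x) - f x + exp ((\<phi> x)\<^sup>2)" for x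
    by (rule young_exp[OF f_nn])
  have sq_le: "(\<phi> x)\<^sup>2 \<le> exp ((\<phi> x)\<^sup>2) - 1" for x
    using exp_ge_add_one_self[of "(\<phi> x)\<^sup>2"] by linarith
  have h_nn: "0 \<le> h x" for x
    using young_exp[OF f_nn, of 0 x] by (simp add: h_def)
  have h_int: "integrable M h"
    unfolding h_def using f_int H_int by simp
  have h_H: "(\<integral>x. h x \<partial>M) = H"
    unfolding h_def H_def using f_int H_int by (simp add: prob_space)
  have H_nn: "0 \<le> H"
    unfolding h_H[symmetric] using h_nn by (simp add: integral_nonneg_AE)
  have "(\<phi> x)\<^sup>2 \<le> exp ((\<phi> x)\<^sup>2)" for x
    using sq_le[of x] by linarith
  hence p_int: "integrable M (\<lambda>x. (\<phi> x)\<^sup>2)"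
    by (intro Bochner_Integration.integrable_bound[OF G_int]) auto
  have pf_int: "integrable M (\<lambda>x. (\<phi> x)\<^sup>2 * f x)"
  proof (rule Bochner_Integration.integrable_bound)
    show "integrable M (\<lambda>x. f x * ln (f x) - f x + exp ((\<phi> x)\<^sup>2))"
      using f_int H_int G_int by simp
    show "AE x in M. norm ((\<phi> x)\<^sup>2 * f x) \<le> norm (f x * ln (f x) - f x + exp ((\<phi> x)\<^sup>2))"
    proof (rule AE_I2)
      fix x
      have "0 \<le> (\<phi> x)\<^sup>2 * f x" using f_nn by simp
      thus "norm ((\<phi> x)\<^sup>2 * f x) \<le> norm (f x * ln (f x) - f x + exp ((\<phi> x)\<^sup>2))"
        using young[of x] unfolding real_norm_def by linarith
    qed
  qed simp
  define P where "P = (\<integral>x. (\<phi> x)\<^sup>2 \<partial>M)"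
  define Q where "Q = (\<integral>x. (\<phi> x)\<^sup>2 * f x \<partial>M)"
  have P_nn: "0 \<le> P" unfolding P_def by simp
  have Q_nn: "0 \<le> Q" unfolding Q_def using f_nn by (simp add: integral_nonneg_AE)
  have P_le: "P \<le> G - 1"
  proof -
    have "P \<le> (\<integral>x. exp ((\<phi> x)\<^sup>2) - 1 \<partial>M)"
      unfolding P_def using p_int G_int sq_le by (intro integral_mono) auto
    thus ?thesis using G_int by (simp add: G_def prob_space)
  qed
  have Q_le: "Q \<le> H + G - 1"
  proof -
    have "Q \<le> (\<integral>x. f x * ln (f x) - f x + exp ((\<phi> x)\<^sup>2) \<partial>M)"
      unfolding Q_def using pf_int G_int f_int H_int young by (intro integral_mono) auto
    thus ?thesis using G_int f_int H_int by (simp add: G_def H_def)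
  qed
  show W_int: "integrable M (\<lambda>x. \<phi> x * \<bar>f x - 1\<bar>)"
  proof (rule Bochner_Integration.integrable_bound)
    show "integrable M (\<lambda>x. (\<phi> x)\<^sup>2 * f x + (\<phi> x)\<^sup>2 + f x + 1)"
      using f_int p_int pf_int by simp
    have "norm (\<phi> x * \<bar>f x - 1\<bar>) \<le> norm ((\<phi> x)\<^sup>2 * f x + (\<phi> x)\<^sup>2 + f x + 1)" for x
    proof -
      have "\<bar>\<phi> x\<bar> \<le> (\<phi> x)\<^sup>2 + 1"
        using zero_le_power2[of "\<bar>\<phi> x\<bar> - 1"] by (simp add: power2_diff)
      moreover have "\<bar>f x - 1\<bar> \<le> f x + 1" using f_nn[of x] by simp
      ultimately have "\<bar>\<phi> x\<bar> * \<bar>f x - 1\<bar> \<le> ((\<phi> x)\<^sup>2 + 1) * (f x + 1)"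
        by (intro mult_mono) auto
      thus ?thesis using f_nn[of x] by (simp add: abs_mult algebra_simps)
    qed
    thus "AE x in M. norm (\<phi> x * \<bar>f x - 1\<bar>) \<le> norm ((\<phi> x)\<^sup>2 * f x + (\<phi> x)\<^sup>2 + f x + 1)" by simp
  qed simp
  define W where "W = (\<integral>x. \<phi> x * \<bar>f x - 1\<bar> \<partial>M)"
  have W_nn: "0 \<le> W" unfolding W_def using \<phi>_nn by (intro integral_nonneg_AE AE_I2) simp
  have K_split: "K = (\<lambda>x. 4 / 3 * (\<phi> x)\<^sup>2 + 2 / 3 * ((\<phi> x)\<^sup>2 * f x))"
    by (auto simp: K_def field_simps)
  have K_int: "integrable M K"
    unfolding K_split using pf_int p_int by simp
  have K_eq: "(\<integral>x. K x \<partial>M) = 4 / 3 * P + 2 / 3 * Q"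
    unfolding K_split using pf_int p_int by (simp add: P_def Q_def)
  have K_nn: "0 \<le> K x" for x unfolding K_def using f_nn[of x] by simp
  have small: "W\<^sup>2 \<le> (4 / 3 * P + 2 / 3 * Q) * H"
  proof -
    have le: "\<phi> x * \<bar>f x - 1\<bar> \<le> sqrt (K x) * sqrt (h x)" if "x \<in> space M" for x
    proof (rule power2_le_imp_le)
      have "(\<phi> x)\<^sup>2 * (3 * (f x - 1)\<^sup>2) \<le> (\<phi> x)\<^sup>2 * ((4 + 2 * f x) * h x)"
        unfolding h_def by (intro mult_left_mono pinsker_pointwise f_nn) simp
      thus "(\<phi> x * \<bar>f x - 1\<bar>)\<^sup>2 \<le> (sqrt (K x) * sqrt (h x))\<^sup>2"
        using K_nn[of x] h_nn[of x] by (simp add: power_mult_distrib K_def)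
    qed (use K_nn h_nn in simp)
    \<comment> \<open>Cauchy-Schwarz is applied to extended nonnegative integrals, so
      \<open>W\<close> is first written as one.\<close>
    have "ennreal W = (\<integral>\<^sup>+x. ennreal (\<phi> x * \<bar>f x - 1\<bar>) \<partial>M)"
      unfolding W_def using W_int \<phi>_nn by (intro nn_integral_eq_integral[symmetric] AE_I2) auto
    also have "\<dots> \<le> (\<integral>\<^sup>+x. ennreal (sqrt (K x)) * ennreal (sqrt (h x)) \<partial>M)"
      using le K_nn h_nn by (intro nn_integral_mono) (simp add: ennreal_mult[symmetric])
    finally have "(ennreal W)\<^sup>2 \<le> (\<integral>\<^sup>+x. ennreal (sqrt (K x)) * ennreal (sqrt (h x)) \<partial>M)\<^sup>2"
      by (rule power_mono) simp
    also have "\<dots> \<le> (\<integral>\<^sup>+x. (ennreal (sqrt (K x)))\<^sup>2 \<partial>M) * (\<integral>\<^sup>+x. (ennreal (sqrt (h x)))\<^sup>2 \<partial>M)"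
      by (rule Cauchy_Schwarz_nn_integral) auto
    also have "\<dots> = ennreal (\<integral>x. K x \<partial>M) * ennreal (\<integral>x. h x \<partial>M)"
      using K_nn h_nn K_int h_int by (simp add: ennreal_power nn_integral_eq_integral)
    also have "\<dots> = ennreal ((4 / 3 * P + 2 / 3 * Q) * H)"
      unfolding K_eq h_H using P_nn Q_nn H_nn by (simp add: ennreal_mult)
    finally show ?thesis
      using W_nn P_nn Q_nn H_nn by (simp add: ennreal_power ennreal_le_iff)
  qed
  have large: "W\<^sup>2 \<le> 2 * P + 2 * Q"
  proof -
    \<comment> \<open>The inequality \<open>2 * s * \<phi> \<le> s^2 + \<phi>^2\<close> is
      integrated against \<open>1 + f\<close>, which has total mass \<open>2\<close>;
      \<open>s\<close> is still free.\<close>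
    have le: "2 * s * W \<le> s\<^sup>2 * 2 + (P + Q)" if "0 < s" for s
    proof -
      have "2 * s * W = (\<integral>x. 2 * s * (\<phi> x * \<bar>f x - 1\<bar>) \<partial>M)"
        by (simp add: W_def)
      also have "\<dots> \<le> (\<integral>x. s\<^sup>2 * (1 + f x) + ((\<phi> x)\<^sup>2 + (\<phi> x)\<^sup>2 * f x) \<partial>M)"
      proof (rule integral_mono)
        fix x assume x: "x \<in> space M"
        have "2 * s * (\<phi> x * \<bar>f x - 1\<bar>) \<le> 2 * s * (\<phi> x * (1 + f x))"
          using f_nn[of x] \<phi>_nn[OF x] that by (intro mult_left_mono) auto
        also have "\<dots> = (2 * s * \<phi> x) * (1 + f x)" by simp
        also have "\<dots> \<le> (s\<^sup>2 + (\<phi> x)\<^sup>2) * (1 + f x)"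
          using f_nn[of x] sum_squares_bound[of s "\<phi> x"] by (intro mult_right_mono) auto
        finally show "2 * s * (\<phi> x * \<bar>f x - 1\<bar>) \<le> s\<^sup>2 * (1 + f x) + ((\<phi> x)\<^sup>2 + (\<phi> x)\<^sup>2 * f x)"
          by (simp add: algebra_simps)
      qed (use W_int f_int p_int pf_int in auto)
      also have "\<dots> = s\<^sup>2 * 2 + (P + Q)"
        using f_int p_int pf_int by (simp add: P_def Q_def prob_space)
      finally show ?thesis .
    qed
    show ?thesis
    proof (cases "W = 0")
      case False
      \<comment> \<open>\<open>s = W / 2\<close> maximises \<open>2 * s * W - 2 * s^2\<close>. It
        has to be positive, so \<open>W = 0\<close> is split off.\<close>
      with W_nn have "0 < W / 2" by simp
      from le[OF this] show ?thesis by (simp add: power2_eq_square field_simps)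
    qed (use P_nn Q_nn in simp)
  qed
  \<comment> \<open>\<open>small\<close> suffices for \<open>H \<le> 3\<close> and \<open>large\<close> for \<open>H \<ge> 2\<close>.\<close>
  have "W\<^sup>2 \<le> 2 * H * G"
  proof (cases "H \<le> 3")
    case True
    \<comment> \<open>The estimates of \<open>P\<close> and \<open>Q\<close> bound the first factor
      by \<open>2 * G - 2 + 2/3 * H\<close>, which is at most \<open>2 * G\<close> for
      \<open>H \<le> 3\<close>.\<close>
    have "(4 / 3 * P + 2 / 3 * Q) * H \<le> (2 * G) * H"
      using P_le Q_le True H_nn by (intro mult_right_mono) auto
    thus ?thesis using small by (simp add: algebra_simps)
  next
    case False
    \<comment> \<open>Here they give \<open>W^2 \<le> 4 * G - 4 + 2 * H\<close>, and this product is
      the amount by which \<open>2 * H * G\<close> exceeds that bound.\<close>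
    have "0 \<le> (G - 1) * (2 * H - 4)" using False P_nn P_le by (intro mult_nonneg_nonneg) auto
    thus ?thesis using large P_le Q_le by (simp add: algebra_simps)
  qed
  thus "(\<integral>x. \<phi> x * \<bar>f x - 1\<bar> \<partial>M)\<^sup>2 \<le> 2 * (\<integral>x. f x * ln (f x) \<partial>M) * (\<integral>x. exp ((\<phi> x)\<^sup>2) \<partial>M)"
    by (simp add: W_def H_def G_def)
qed

section \<open>A coupling that keeps the common mass in place\<close>

text \<open>The common part \<open>min 1 f\<close> stays on the diagonal, and the excess of
  \<open>\<mu>\<close> is sent independently to where mass is missing. A cost vanishing on the
  diagonal sees only the second part, and a bound of the form \<open>F x + F y\<close> needs only
  the marginals of that part, whose densities add up to \<open>|f - 1|\<close>.\<close>

lemma trivial_coupling: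
  fixes f :: "'a \<Rightarrow> real"
  assumes "prob_space \<mu>"
    and [measurable]: "f \<in> borel_measurable \<mu>"
    and f_nn: "\<And>x. 0 \<le> f x"
    and f_int: "(\<integral>\<^sup>+x. ennreal (f x) \<partial>\<mu>) = 1"
  obtains \<pi> where "\<pi> \<in> couplings \<mu> (density \<mu> (\<lambda>x. ennreal (f x)))"
    and "\<And>c F. c \<in> borel_measurable (\<mu> \<Otimes>\<^sub>M \<mu>) \<Longrightarrow> F \<in> borel_measurable \<mu> \<Longrightarrow>
      (\<And>x. x \<in> space \<mu> \<Longrightarrow> c (x, x) = 0) \<Longrightarrow>
      (\<And>x y. x \<in> space \<mu> \<Longrightarrow> y \<in> space \<mu> \<Longrightarrow> c (x, y) \<le> F x + F y) \<Longrightarrow>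
      (\<integral>\<^sup>+z. c z \<partial>\<pi>) \<le> (\<integral>\<^sup>+x. F x * ennreal \<bar>f x - 1\<bar> \<partial>\<mu>)"
proof -
  interpret prob_space \<mu> by fact
  interpret \<mu>\<mu>: pair_prob_space \<mu> \<mu> ..
  \<comment> \<open>\<open>ennreal\<close> truncates negative values to \<open>0\<close>, so
    \<open>p\<close> and \<open>q\<close> are the positive parts of \<open>1 - f\<close> and
    \<open>f - 1\<close>.\<close>
  define g p q where "g = (\<lambda>x. ennreal (min 1 (f x)))"
    and "p = (\<lambda>x. ennreal (1 - f x))" and "q = (\<lambda>x. ennreal (f x - 1))"
  have [measurable]: "g \<in> borel_measurable \<mu>" "p \<in> borel_measurable \<mu>" "q \<in> borel_measurable \<mu>"
    by (simp_all add: g_def p_def q_def)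
  have gp: "g x + p x = 1" for x
    using f_nn[of x] by (cases "f x \<le> 1") (simp_all add: g_def p_def ennreal_plus[symmetric] ennreal_neg del: ennreal_plus)
  have gq: "g x + q x = ennreal (f x)" for x
    using f_nn[of x] by (cases "f x \<le> 1")
      (simp_all add: g_def q_def ennreal_plus[symmetric] ennreal_neg del: ennreal_plus ennreal_1 flip: ennreal_1)
  have pq: "p x + q x = ennreal \<bar>f x - 1\<bar>" for x
    by (cases "f x \<le> 1") (simp_all add: p_def q_def ennreal_neg)
  define m where "m = (\<integral>\<^sup>+x. p x \<partial>\<mu>)"
  have gm: "(\<integral>\<^sup>+x. g x \<partial>\<mu>) + m = 1"
    unfolding m_def by (subst nn_integral_add[symmetric]) (simp_all add: gp emeasure_space_1)
  have "(\<integral>\<^sup>+x. g x \<partial>\<mu>) + (\<integral>\<^sup>+x. q x \<partial>\<mu>) = 1"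
    by (subst nn_integral_add[symmetric]) (simp_all add: gq f_int)
  \<comment> \<open>Both measures have mass \<open>1\<close> and share the part \<open>g\<close>,
    whose integral is finite and can be cancelled.\<close>
  with gm have m_q: "(\<integral>\<^sup>+x. q x \<partial>\<mu>) = m"
    by (metis ennreal_add_left_cancel ennreal_add_eq_top ennreal_one_neq_top)
  have m_top: "m \<noteq> \<top>" using gm by (metis ennreal_add_eq_top ennreal_one_neq_top)
  \<comment> \<open>The normalisation \<open>1 / m\<close> of the product part. If
    \<open>m = 0\<close>, the measures agree: \<open>p\<close> and \<open>q\<close> vanish almost
    everywhere, so \<open>AE_p\<close> and \<open>AE_q\<close> still hold.\<close>
  define c where "c = (if m = 0 then 0 else 1 / m)"
  have AE_p: "AE x in \<mu>. p x * (c * m) = p x" and AE_q: "AE x in \<mu>. q x * (c * m) = q x"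
  proof -
    have "(AE x in \<mu>. p x * (c * m) = p x) \<and> (AE x in \<mu>. q x * (c * m) = q x)"
    proof (cases "m = 0")
      case True
      hence "AE x in \<mu>. p x = 0" "AE x in \<mu>. q x = 0"
        using nn_integral_0_iff_AE[of p \<mu>] nn_integral_0_iff_AE[of q \<mu>] m_q by (simp_all add: m_def)
      thus ?thesis by auto
    next
      case False
      hence "c * m = 1" using m_top by (simp add: c_def ennreal_divide_times ennreal_divide_self less_top)
      thus ?thesis by simp
    qed
    thus "AE x in \<mu>. p x * (c * m) = p x" "AE x in \<mu>. q x * (c * m) = q x" by auto
  qed
  \<comment> \<open>The Boolean chooses between the diagonal part \<open>g\<close> and the product part \<open>p \<otimes> q / m\<close>.\<close>
  define N where "N = (\<mu> \<Otimes>\<^sub>M \<mu>) \<Otimes>\<^sub>M count_space (UNIV :: bool set)"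
  define w where "w = (\<lambda>(z, b). if b then g (fst z) else p (fst z) * (c * q (snd z)))"
  define T :: "('a \<times> 'a) \<times> bool \<Rightarrow> 'a \<times> 'a" where "T = (\<lambda>(z, b). if b then (fst z, fst z) else z)"
  have snd_pred[measurable]: "Measurable.pred N snd"
    unfolding N_def by (rule measurable_snd)
  have w_meas[measurable]: "w \<in> borel_measurable N"
    using snd_pred unfolding w_def N_def by (simp add: case_prod_beta)
  have T_meas[measurable]: "T \<in> measurable N (\<mu> \<Otimes>\<^sub>M \<mu>)"
    using snd_pred unfolding T_def N_def by (simp add: case_prod_beta)
  \<comment> \<open>As the pushforward of a single density, the sum of the two parts is a measure by
    construction.\<close>
  define \<pi> where "\<pi> = distr (density N w) (\<mu> \<Otimes>\<^sub>M \<mu>) T"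
  interpret B: sigma_finite_measure "count_space (UNIV :: bool set)"
    by (rule sigma_finite_measure_count_space_finite) simp
  have sets_\<pi>[measurable_cong]: "sets \<pi> = sets (\<mu> \<Otimes>\<^sub>M \<mu>)" by (simp add: \<pi>_def)
  \<comment> \<open>Both marginals and the cost estimate follow from this formula by a choice of
    \<open>h\<close>.\<close>
  have \<pi>_int: "(\<integral>\<^sup>+z. h z \<partial>\<pi>) = (\<integral>\<^sup>+x. g x * h (x, x) \<partial>\<mu>) + (\<integral>\<^sup>+x. \<integral>\<^sup>+y. p x * (c * q y) * h (x, y) \<partial>\<mu> \<partial>\<mu>)"
    if [measurable]: "h \<in> borel_measurable (\<mu> \<Otimes>\<^sub>M \<mu>)" for h
  proof -
    have "(\<integral>\<^sup>+z. h z \<partial>\<pi>) = (\<integral>\<^sup>+z. w z * h (T z) \<partial>N)"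
      unfolding \<pi>_def by (subst nn_integral_distr) (simp_all add: nn_integral_density)
    also have "\<dots> = (\<integral>\<^sup>+z. \<integral>\<^sup>+b. w (z, b) * h (T (z, b)) \<partial>count_space UNIV \<partial>(\<mu> \<Otimes>\<^sub>M \<mu>))"
      unfolding N_def by (subst B.nn_integral_fst[symmetric]) (simp_all add: N_def[symmetric])
    also have "\<dots> = (\<integral>\<^sup>+z. g (fst z) * h (fst z, fst z) + p (fst z) * (c * q (snd z)) * h z \<partial>(\<mu> \<Otimes>\<^sub>M \<mu>))"
      by (intro nn_integral_cong)
         (auto simp: nn_integral_count_space_finite UNIV_bool w_def T_def add.commute)
    also have "\<dots> = (\<integral>\<^sup>+z. g (fst z) * h (fst z, fst z) \<partial>(\<mu> \<Otimes>\<^sub>M \<mu>)) + (\<integral>\<^sup>+z. p (fst z) * (c * q (snd z)) * h z \<partial>(\<mu> \<Otimes>\<^sub>M \<mu>))"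
      by (rule nn_integral_add) measurable
    also have "(\<integral>\<^sup>+z. g (fst z) * h (fst z, fst z) \<partial>(\<mu> \<Otimes>\<^sub>M \<mu>)) = (\<integral>\<^sup>+x. g x * h (x, x) \<partial>\<mu>)"
      by (subst nn_integral_fst[symmetric]) (simp_all add: emeasure_space_1)
    also have "(\<integral>\<^sup>+z. p (fst z) * (c * q (snd z)) * h z \<partial>(\<mu> \<Otimes>\<^sub>M \<mu>)) = (\<integral>\<^sup>+x. \<integral>\<^sup>+y. p x * (c * q y) * h (x, y) \<partial>\<mu> \<partial>\<mu>)"
      by (subst nn_integral_fst[symmetric]) simp_all
    finally show ?thesis .
  qed
  \<comment> \<open>For a test function of the first coordinate alone, \<open>q\<close> integrates
    to \<open>m\<close>, and \<open>AE_p\<close> removes \<open>c * m\<close>. The formula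
    \<open>int_q\<close> is the mirror image.\<close>
  have int_p: "(\<integral>\<^sup>+x. \<integral>\<^sup>+y. p x * (c * q y) * h x \<partial>\<mu> \<partial>\<mu>) = (\<integral>\<^sup>+x. p x * h x \<partial>\<mu>)"
    if [measurable]: "h \<in> borel_measurable \<mu>" for h
  proof -
    have "(\<integral>\<^sup>+x. \<integral>\<^sup>+y. p x * (c * q y) * h x \<partial>\<mu> \<partial>\<mu>) = (\<integral>\<^sup>+x. \<integral>\<^sup>+y. (p x * c * h x) * q y \<partial>\<mu> \<partial>\<mu>)"
      by (intro nn_integral_cong) (simp add: ac_simps)
    also have "\<dots> = (\<integral>\<^sup>+x. p x * (c * m) * h x \<partial>\<mu>)"
      by (subst nn_integral_cmult) (simp_all add: m_q ac_simps)
    also have "\<dots> = (\<integral>\<^sup>+x. p x * h x \<partial>\<mu>)"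
      using AE_p by (intro nn_integral_cong_AE) auto
    finally show ?thesis .
  qed
  have int_q: "(\<integral>\<^sup>+x. \<integral>\<^sup>+y. p x * (c * q y) * h y \<partial>\<mu> \<partial>\<mu>) = (\<integral>\<^sup>+x. q x * h x \<partial>\<mu>)"
    if [measurable]: "h \<in> borel_measurable \<mu>" for h
  proof -
    have "(\<integral>\<^sup>+x. \<integral>\<^sup>+y. p x * (c * q y) * h y \<partial>\<mu> \<partial>\<mu>) = (\<integral>\<^sup>+y. \<integral>\<^sup>+x. (c * q y * h y) * p x \<partial>\<mu> \<partial>\<mu>)"
      by (subst \<mu>\<mu>.Fubini') (auto simp: ac_simps)
    also have "\<dots> = (\<integral>\<^sup>+y. q y * (c * m) * h y \<partial>\<mu>)"
      by (subst nn_integral_cmult) (simp_all add: m_def ac_simps)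
    also have "\<dots> = (\<integral>\<^sup>+x. q x * h x \<partial>\<mu>)"
      using AE_q by (intro nn_integral_cong_AE) auto
    finally show ?thesis .
  qed
  have fst_\<pi>: "distr \<pi> \<mu> fst = \<mu>"
  proof (rule measure_eqI)
    fix A assume "A \<in> sets (distr \<pi> \<mu> fst)"
    hence [measurable]: "A \<in> sets \<mu>" by simp
    have "emeasure (distr \<pi> \<mu> fst) A = (\<integral>\<^sup>+x. indicator A x \<partial>(distr \<pi> \<mu> fst))" by simp
    also have "\<dots> = (\<integral>\<^sup>+z. indicator A (fst z) \<partial>\<pi>)" by (rule nn_integral_distr) auto
    also have "\<dots> = (\<integral>\<^sup>+x. g x * indicator A x \<partial>\<mu>) + (\<integral>\<^sup>+x. p x * indicator A x \<partial>\<mu>)"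
      by (subst \<pi>_int) (simp_all add: int_p)
    also have "\<dots> = (\<integral>\<^sup>+x. (g x + p x) * indicator A x \<partial>\<mu>)"
      by (subst nn_integral_add[symmetric]) (simp_all add: algebra_simps)
    finally show "emeasure (distr \<pi> \<mu> fst) A = emeasure \<mu> A" by (simp add: gp)
  qed simp
  have snd_\<pi>: "distr \<pi> (density \<mu> (\<lambda>x. ennreal (f x))) snd = density \<mu> (\<lambda>x. ennreal (f x))"
  proof (rule measure_eqI)
    fix A assume "A \<in> sets (distr \<pi> (density \<mu> (\<lambda>x. ennreal (f x))) snd)"
    hence [measurable]: "A \<in> sets \<mu>" by simp
    have "emeasure (distr \<pi> (density \<mu> (\<lambda>x. ennreal (f x))) snd) A
        = (\<integral>\<^sup>+x. indicator A x \<partial>(distr \<pi> (density \<mu> (\<lambda>x. ennreal (f x))) snd))" by simp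
    also have "\<dots> = (\<integral>\<^sup>+z. indicator A (snd z) \<partial>\<pi>)" by (rule nn_integral_distr) auto
    also have "\<dots> = (\<integral>\<^sup>+x. g x * indicator A x \<partial>\<mu>) + (\<integral>\<^sup>+x. q x * indicator A x \<partial>\<mu>)"
      by (subst \<pi>_int) (simp_all add: int_q)
    also have "\<dots> = (\<integral>\<^sup>+x. (g x + q x) * indicator A x \<partial>\<mu>)"
      by (subst nn_integral_add[symmetric]) (simp_all add: algebra_simps)
    finally show "emeasure (distr \<pi> (density \<mu> (\<lambda>x. ennreal (f x))) snd) A
        = emeasure (density \<mu> (\<lambda>x. ennreal (f x))) A"
      by (simp add: gq emeasure_density)
  qed simp
  have "prob_space \<pi>"
  proof (rule prob_spaceI)
    have "emeasure \<pi> (space \<pi>) = emeasure (distr \<pi> \<mu> fst) (space \<mu>)"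
      using sets_eq_imp_space_eq[OF sets_\<pi>]
      by (subst emeasure_distr) (auto intro!: arg_cong[where f="emeasure \<pi>"] simp: space_pair_measure)
    thus "emeasure \<pi> (space \<pi>) = 1" by (simp add: fst_\<pi> emeasure_space_1)
  qed
  moreover have "sets \<pi> = sets (\<mu> \<Otimes>\<^sub>M density \<mu> (\<lambda>x. ennreal (f x)))"
    unfolding sets_\<pi> by (rule sets_pair_measure_cong) simp_all
  ultimately have "\<pi> \<in> couplings \<mu> (density \<mu> (\<lambda>x. ennreal (f x)))"
    using fst_\<pi> snd_\<pi> by (simp add: couplings_def)
  moreover have "(\<integral>\<^sup>+z. k z \<partial>\<pi>) \<le> (\<integral>\<^sup>+x. F x * ennreal \<bar>f x - 1\<bar> \<partial>\<mu>)"
    if [measurable]: "k \<in> borel_measurable (\<mu> \<Otimes>\<^sub>M \<mu>)" "F \<in> borel_measurable \<mu>"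
      and k0: "\<And>x. x \<in> space \<mu> \<Longrightarrow> k (x, x) = 0"
      and k_le: "\<And>x y. x \<in> space \<mu> \<Longrightarrow> y \<in> space \<mu> \<Longrightarrow> k (x, y) \<le> F x + F y" for k F
  proof -
    have "(\<integral>\<^sup>+x. g x * k (x, x) \<partial>\<mu>) = (\<integral>\<^sup>+x. 0 \<partial>\<mu>)"
      using k0 by (intro nn_integral_cong) simp
    hence "(\<integral>\<^sup>+z. k z \<partial>\<pi>) = (\<integral>\<^sup>+x. \<integral>\<^sup>+y. p x * (c * q y) * k (x, y) \<partial>\<mu> \<partial>\<mu>)"
      by (simp add: \<pi>_int)
    \<comment> \<open>The bound separates the two coordinates, so \<open>int_p\<close> and
      \<open>int_q\<close> apply and leave the weight \<open>p x + q x\<close>.\<close>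
    also have "\<dots> \<le> (\<integral>\<^sup>+x. \<integral>\<^sup>+y. p x * (c * q y) * F x + p x * (c * q y) * F y \<partial>\<mu> \<partial>\<mu>)"
      using k_le by (intro nn_integral_mono) (metis distrib_left mult_left_mono zero_le)
    also have "\<dots> = (\<integral>\<^sup>+x. p x * F x \<partial>\<mu>) + (\<integral>\<^sup>+x. q x * F x \<partial>\<mu>)"
      by (simp add: nn_integral_add int_p int_q)
    also have "\<dots> = (\<integral>\<^sup>+x. F x * (p x + q x) \<partial>\<mu>)"
      by (subst nn_integral_add[symmetric]) (simp_all add: algebra_simps)
    finally show ?thesis by (simp add: pq)
  qed
  ultimately show ?thesis by (rule that)
qed

section \<open>Relative entropy in terms of densities\<close>

text \<open>Supplies the entropy in the form used by \<open>weighted_pinsker\<close>. The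
  Radon-Nikodym derivative has extended values, but as \<open>\<nu>\<close> is finite it has a
  version that is real and nonnegative everywhere; integrals against \<open>\<nu>\<close> then
  become integrals against \<open>\<mu>\<close> with the factor \<open>f\<close>.\<close>

lemma relative_entropy_finite_density:
  assumes "prob_space \<mu>" "prob_space \<nu>" "sets \<nu> = sets \<mu>" "relative_entropy \<nu> \<mu> < \<infinity>"
  obtains f :: "'a \<Rightarrow> real" where "f \<in> borel_measurable \<mu>" "\<And>x. 0 \<le> f x"
    "\<nu> = density \<mu> (\<lambda>x. ennreal (f x))" "integrable \<mu> (\<lambda>x. f x * ln (f x))"
    "relative_entropy \<nu> \<mu> = ereal (\<integral>x. f x * ln (f x) \<partial>\<mu>)"
proof -
  interpret prob_space \<mu> by fact
  interpret \<nu>: prob_space \<nu> by fact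
  have ac: "absolutely_continuous \<mu> \<nu>" and int: "integrable \<nu> (entropy_density (exp 1) \<mu> \<nu>)"
    and re: "relative_entropy \<nu> \<mu> = ereal (KL_divergence (exp 1) \<mu> \<nu>)"
    using assms(4) by (auto simp: relative_entropy_def split: if_splits)
  obtain f where [measurable]: "f \<in> borel_measurable \<mu>" and
    f: "AE x in \<mu>. RN_deriv \<mu> \<nu> x = ennreal (f x)" and f_nn: "\<And>x. 0 \<le> f x"
    by (rule real_RN_deriv[OF \<nu>.finite_measure_axioms ac assms(3)]) auto
  have "density \<mu> (RN_deriv \<mu> \<nu>) = \<nu>" by (rule density_RN_deriv[OF ac assms(3)])
  moreover have "density \<mu> (RN_deriv \<mu> \<nu>) = density \<mu> (\<lambda>x. ennreal (f x))"
    by (rule density_cong) (use f in auto)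
  ultimately have \<nu>: "\<nu> = density \<mu> (\<lambda>x. ennreal (f x))" by simp
  have "integrable \<mu> (\<lambda>x. f x * entropy_density (exp 1) \<mu> \<nu> x)"
    using int f_nn by (subst (asm) (1) \<nu>) (simp add: integrable_real_density)
  moreover have "AE x in \<mu>. f x * entropy_density (exp 1) \<mu> \<nu> x = f x * ln (f x)"
    using f by eventually_elim (use f_nn in \<open>simp add: entropy_density_def log_ln\<close>)
  ultimately have "integrable \<mu> (\<lambda>x. f x * ln (f x))"
    by (subst (asm) integrable_cong_AE) auto
  moreover have "relative_entropy \<nu> \<mu> = ereal (\<integral>x. f x * ln (f x) \<partial>\<mu>)"
    unfolding re unfolding \<nu> using f_nn by (subst KL_density) (auto simp: log_ln)
  ultimately show ?thesis using that[of f] f_nn \<nu> by simp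
qed

text \<open>The density is the constant \<open>1 / measure \<mu> B\<close> on \<open>B\<close>, and
  \<open>B\<close> has full conditional measure, so the logarithm of the density is constant almost
  everywhere.\<close>

lemma relative_entropy_uniform_measure:
  assumes "prob_space \<mu>" "B \<in> sets \<mu>" "emeasure \<mu> B \<noteq> 0"
  shows "relative_entropy (uniform_measure \<mu> B) \<mu> = ereal (- ln (measure \<mu> B))"
proof -
  interpret prob_space \<mu> by fact
  let ?\<nu> = "uniform_measure \<mu> B"
  note [measurable] = assms(2)
  have pos: "0 < measure \<mu> B"
    using assms(3) by (simp add: emeasure_eq_measure zero_less_measure_iff)
  interpret \<nu>: prob_space ?\<nu>
    using assms(3) by (rule prob_space_uniform_measure) simp
  have "AE x in \<mu>. indicator B x / emeasure \<mu> B = RN_deriv \<mu> ?\<nu> x"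
    by (rule RN_deriv_unique) (simp_all add: uniform_measure_def)
  hence "AE x in \<mu>. x \<in> B \<longrightarrow> entropy_density (exp 1) \<mu> ?\<nu> x = - ln (measure \<mu> B)"
  proof eventually_elim
    case (elim x)
    show ?case
    proof
      assume "x \<in> B"
      with elim have "RN_deriv \<mu> ?\<nu> x = ennreal (1 / measure \<mu> B)"
        using pos by (simp add: emeasure_eq_measure divide_ennreal flip: ennreal_1)
      thus "entropy_density (exp 1) \<mu> ?\<nu> x = - ln (measure \<mu> B)"
        using pos by (simp add: entropy_density_def log_ln[symmetric] ln_div)
    qed
  qed
  hence "AE x in ?\<nu>. entropy_density (exp 1) \<mu> ?\<nu> x = - ln (measure \<mu> B)"
    by (intro AE_uniform_measureI) auto
  moreover have "measure ?\<nu> (space \<mu>) = 1" using \<nu>.prob_space by simp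
  moreover have "entropy_density (exp 1) \<mu> ?\<nu> \<in> borel_measurable ?\<nu>" by simp
  ultimately have "integrable ?\<nu> (entropy_density (exp 1) \<mu> ?\<nu>)"
    "KL_divergence (exp 1) \<mu> ?\<nu> = - ln (measure \<mu> B)"
    by (simp_all add: KL_divergence_def integrable_cong_AE[of _ ?\<nu> "\<lambda>_. - ln (measure \<mu> B)"]
        integral_cong_AE[of _ ?\<nu> "\<lambda>_. - ln (measure \<mu> B)"])
  moreover have "absolutely_continuous \<mu> ?\<nu>"
    unfolding uniform_measure_def by (rule absolutely_continuousI_density) simp
  ultimately show ?thesis by (simp add: relative_entropy_def)
qed

section \<open>From a Gaussian moment to the transport inequality\<close>

text \<open>The outer root is trivial for exponent \<open>1\<close>. The inner \<open>powr 1\<close>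
  stays, since removing it depends on the sign of \<open>d\<close>.\<close>

lemma wasserstein_1:
  "wasserstein 1 d \<mu> \<nu> = (INF \<pi>\<in>couplings \<mu> \<nu>. \<integral>\<^sup>+(x, y). ennreal (d x y powr 1) \<partial>\<pi>)"
proof -
  have "ennreal_powr x (1 / 1) = x" for x
    by (cases x) (auto simp: ennreal_powr_def)
  thus ?thesis unfolding wasserstein_def by simp
qed

text \<open>The Wasserstein distance does not depend on the base point \<open>y\<close>, so
  averaging \<open>W_le\<close> over \<open>y\<close> leaves its left-hand side as it is and turns
  the inner moment \<open>I y\<close> into the double integral.\<close>

lemma transport_inequality_if_gauss_moment:
  assumes "Metric_space (space \<mu>) d" "prob_space \<mu>"
    and d_meas[measurable]: "(\<lambda>(x, y). d x y) \<in> borel_measurable (\<mu> \<Otimes>\<^sub>M \<mu>)"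
    and \<delta>: "0 < \<delta>" and fin: "gauss_moment d \<mu> \<delta> < \<infinity>"
  shows "transport_inequality 1 d (enn2real (gauss_moment d \<mu> \<delta>) / \<delta>) \<mu>"
  unfolding transport_inequality_def
proof (intro conjI allI impI)
  interpret prob_space \<mu> by fact
  interpret Metric_space "space \<mu>" d by fact
  define C where "C = enn2real (gauss_moment d \<mu> \<delta>) / \<delta>"
  show "0 \<le> enn2real (gauss_moment d \<mu> \<delta>) / \<delta>" using \<delta> by simp
  fix \<nu> assume "prob_space \<nu> \<and> sets \<nu> = sets \<mu> \<and> relative_entropy \<nu> \<mu> < \<infinity>"
  hence \<nu>: "prob_space \<nu>" "sets \<nu> = sets \<mu>" "relative_entropy \<nu> \<mu> < \<infinity>" by auto
  obtain f where [measurable]: "f \<in> borel_measurable \<mu>" and f_nn: "\<And>x. 0 \<le> f x"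
    and \<nu>_f: "\<nu> = density \<mu> (\<lambda>x. ennreal (f x))"
    and H_int: "integrable \<mu> (\<lambda>x. f x * ln (f x))"
    and re: "relative_entropy \<nu> \<mu> = ereal (\<integral>x. f x * ln (f x) \<partial>\<mu>)"
    by (rule relative_entropy_finite_density[OF assms(2) \<nu>]) blast
  define H where "H = (\<integral>x. f x * ln (f x) \<partial>\<mu>)"
  have f1: "(\<integral>\<^sup>+x. ennreal (f x) \<partial>\<mu>) = 1"
    using prob_space.emeasure_space_1[OF \<nu>(1)] by (simp add: \<nu>_f emeasure_density cong: nn_integral_cong)
  have f_int: "integrable \<mu> f" "(\<integral>x. f x \<partial>\<mu>) = 1"
    using f1 f_nn by (auto intro!: integrableI_nonneg simp: integral_eq_nn_integral)
  have H_nn: "0 \<le> H"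
  proof -
    have "0 \<le> (\<integral>x. f x * ln (f x) - f x + 1 \<partial>\<mu>)"
      using young_exp[OF f_nn, of 0] by (intro integral_nonneg_AE AE_I2) simp
    thus ?thesis using f_int H_int by (simp add: H_def prob_space)
  qed
  define W where "W = wasserstein 1 d \<mu> \<nu>"
  define I where "I = (\<lambda>y. \<integral>\<^sup>+x. ennreal (exp (\<delta> * (d x y)\<^sup>2)) \<partial>\<mu>)"
  \<comment> \<open>The outer variable \<open>y\<close> of the moment is the second argument of
    \<open>d\<close>, so measurability is needed with the coordinates swapped.\<close>
  have d'[measurable]: "(\<lambda>z. d (snd z) (fst z)) \<in> borel_measurable (\<mu> \<Otimes>\<^sub>M \<mu>)"
    using measurable_pair_swap[OF d_meas] by (simp add: case_prod_beta)
  have I_meas[measurable]: "I \<in> borel_measurable \<mu>"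
    unfolding I_def by (rule borel_measurable_nn_integral) (simp add: case_prod_beta)
  have I_int: "(\<integral>\<^sup>+y. I y \<partial>\<mu>) = gauss_moment d \<mu> \<delta>"
    by (simp add: I_def gauss_moment_def)
  have W_le: "ennreal \<delta> * W\<^sup>2 \<le> ennreal (2 * H) * I y" if y: "y \<in> space \<mu>" and Iy: "I y \<noteq> \<infinity>" for y
  proof -
    have dy[measurable]: "(\<lambda>x. d x y) \<in> borel_measurable \<mu>"
      using measurable_compose[OF measurable_Pair1'[OF y] d'] by simp
    \<comment> \<open>The factor \<open>sqrt \<delta>\<close> makes
      \<open>exp ((\<phi> x)\<^sup>2)\<close> the integrand of \<open>I y\<close>; it is divided out
      again below.\<close>
    define \<phi> where "\<phi> = (\<lambda>x. sqrt \<delta> * d x y)"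
    have [measurable]: "\<phi> \<in> borel_measurable \<mu>" unfolding \<phi>_def by simp
    have sq: "(\<phi> x)\<^sup>2 = \<delta> * (d x y)\<^sup>2" for x using \<delta> by (simp add: \<phi>_def power_mult_distrib)
    have G_int: "integrable \<mu> (\<lambda>x. exp ((\<phi> x)\<^sup>2))"
      using Iy by (auto intro!: integrableI_nonneg simp: sq I_def less_top)
    have G: "ennreal (\<integral>x. exp ((\<phi> x)\<^sup>2) \<partial>\<mu>) = I y"
      using nn_integral_eq_integral[OF G_int] by (simp add: sq I_def)
    have \<phi>_nn: "0 \<le> \<phi> x" if "x \<in> space \<mu>" for x using \<delta> by (simp add: \<phi>_def)
    note wp = weighted_pinsker[OF _ _ f_nn \<phi>_nn f_int H_int G_int, simplified]
    define V where "V = (\<integral>x. \<phi> x * \<bar>f x - 1\<bar> \<partial>\<mu>)"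
    have V_nn: "0 \<le> V" unfolding V_def using \<phi>_nn by (intro integral_nonneg_AE AE_I2) simp
    have V2: "V\<^sup>2 \<le> 2 * H * (\<integral>x. exp ((\<phi> x)\<^sup>2) \<partial>\<mu>)"
      unfolding V_def H_def by (rule wp(2))
    obtain \<pi> where \<pi>: "\<pi> \<in> couplings \<mu> \<nu>"
      and \<pi>_le: "\<And>c F. c \<in> borel_measurable (\<mu> \<Otimes>\<^sub>M \<mu>) \<Longrightarrow> F \<in> borel_measurable \<mu> \<Longrightarrow>
        (\<And>x. x \<in> space \<mu> \<Longrightarrow> c (x, x) = 0) \<Longrightarrow>
        (\<And>x y. x \<in> space \<mu> \<Longrightarrow> y \<in> space \<mu> \<Longrightarrow> c (x, y) \<le> F x + F y) \<Longrightarrow>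
        (\<integral>\<^sup>+z. c z \<partial>\<pi>) \<le> (\<integral>\<^sup>+x. F x * ennreal \<bar>f x - 1\<bar> \<partial>\<mu>)"
      unfolding \<nu>_f by (rule trivial_coupling[OF assms(2) _ f_nn f1]) auto
    have "W \<le> (\<integral>\<^sup>+(x, y). ennreal (d x y powr 1) \<partial>\<pi>)"
      unfolding W_def wasserstein_1 by (rule INF_lower[OF \<pi>])
    also have "\<dots> \<le> (\<integral>\<^sup>+x. ennreal (d x y) * ennreal \<bar>f x - 1\<bar> \<partial>\<mu>)"
    proof (rule \<pi>_le)
      show "(\<lambda>(x, y). ennreal (d x y powr 1)) \<in> borel_measurable (\<mu> \<Otimes>\<^sub>M \<mu>)"
        using d_meas by (simp add: case_prod_beta)
      \<comment> \<open>The triangle inequality through the base point \<open>y\<close> splits the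
        cost as \<open>trivial_coupling\<close> requires.\<close>
      show "(case (u, v) of (x, y) \<Rightarrow> ennreal (d x y powr 1)) \<le> ennreal (d u y) + ennreal (d v y)"
        if "u \<in> space \<mu>" "v \<in> space \<mu>" for u v
        using triangle[of u y v] commute[of v y] that y by (simp add: ennreal_plus[symmetric] del: ennreal_plus)
    qed simp_all
    also have "\<dots> = (\<integral>\<^sup>+x. ennreal (1 / sqrt \<delta>) * ennreal (\<phi> x * \<bar>f x - 1\<bar>) \<partial>\<mu>)"
      using \<delta> by (intro nn_integral_cong) (simp add: \<phi>_def ennreal_mult[symmetric])
    also have "\<dots> = ennreal (1 / sqrt \<delta>) * ennreal V"
      unfolding V_def using \<phi>_nn wp(1)
      by (subst nn_integral_cmult) (auto simp: nn_integral_eq_integral)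
    also have "\<dots> = ennreal (V / sqrt \<delta>)"
      using \<delta> V_nn by (simp add: ennreal_mult[symmetric])
    finally have "ennreal \<delta> * W\<^sup>2 \<le> ennreal \<delta> * (ennreal (V / sqrt \<delta>))\<^sup>2"
      by (intro mult_left_mono power_mono) auto
    also have "\<dots> = ennreal (V\<^sup>2)"
      using \<delta> V_nn by (simp add: ennreal_power ennreal_mult[symmetric] power_divide)
    also have "\<dots> \<le> ennreal (2 * H * (\<integral>x. exp ((\<phi> x)\<^sup>2) \<partial>\<mu>))"
      by (rule ennreal_leI[OF V2])
    also have "\<dots> = ennreal (2 * H) * I y"
      using H_nn by (simp add: ennreal_mult' flip: G)
    finally show ?thesis .
  qed
  \<comment> \<open>The double integral is finite, so the inner one is finite for almost every base
    point, and only there does \<open>W_le\<close> apply.\<close>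
  have "AE y in \<mu>. I y \<noteq> \<infinity>"
    using fin I_int by (intro nn_integral_PInf_AE) auto
  hence "AE y in \<mu>. ennreal \<delta> * W\<^sup>2 \<le> ennreal (2 * H) * I y"
    using AE_space by eventually_elim (rule W_le)
  hence "(\<integral>\<^sup>+y. ennreal \<delta> * W\<^sup>2 \<partial>\<mu>) \<le> (\<integral>\<^sup>+y. ennreal (2 * H) * I y \<partial>\<mu>)"
    by (rule nn_integral_mono_AE)
  also have "\<dots> = ennreal (2 * H) * gauss_moment d \<mu> \<delta>"
    by (subst nn_integral_cmult) (simp_all add: I_int)
  \<comment> \<open>\<open>C\<close> is the moment divided by \<open>\<delta>\<close> precisely to
    make this an identity.\<close>
  also have "\<dots> = ennreal \<delta> * ennreal (2 * C * H)"
    using fin \<delta> H_nn unfolding C_def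
    by (cases "gauss_moment d \<mu> \<delta>") (auto simp: ennreal_mult[symmetric] mult_ac)
  finally have "ennreal \<delta> * W\<^sup>2 \<le> ennreal \<delta> * ennreal (2 * C * H)"
    by (simp add: emeasure_space_1)
  hence "W\<^sup>2 \<le> ennreal (2 * C * H)"
    using \<delta> by (subst (asm) ennreal_mult_le_mult_iff) auto
  also have "\<dots> = (ennreal (sqrt (2 * C * H)))\<^sup>2"
    using \<delta> H_nn by (simp add: ennreal_power C_def)
  finally have W2: "W\<^sup>2 \<le> (ennreal (sqrt (2 * C * H)))\<^sup>2" .
  have "W \<le> ennreal (sqrt (2 * C * H))"
  proof (cases W)
    case (real w)
    have nn: "0 \<le> sqrt (2 * C * H)" using \<delta> H_nn by (simp add: C_def)
    have "w\<^sup>2 \<le> (sqrt (2 * C * H))\<^sup>2"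
      using W2 real(1) unfolding real(2) ennreal_power[OF real(1)] ennreal_power[OF nn]
      by (subst (asm) ennreal_le_iff) simp_all
    hence "w \<le> sqrt (2 * C * H)" using nn by (rule power2_le_imp_le)
    thus ?thesis unfolding real(2) by (rule ennreal_leI)
  next
    case top
    hence "W\<^sup>2 = \<top>" by (simp add: power2_eq_square ennreal_mult_top)
    with W2 have "(ennreal (sqrt (2 * C * H)))\<^sup>2 = \<top>" by (simp only: top_unique)
    thus ?thesis by (simp add: power_eq_top_ennreal)
  qed
  thus "wasserstein 1 d \<mu> \<nu> \<le> ennreal (sqrt (2 * (enn2real (gauss_moment d \<mu> \<delta>) / \<delta>) *
      real_of_ereal (relative_entropy \<nu> \<mu>)))"
    by (simp add: W_def C_def re H_def)
qed

section \<open>From the transport inequality to Gaussian tails and moments\<close>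

text \<open>Under any coupling the second coordinate lies in \<open>B\<close> almost surely, so each
  pair starting in \<open>A\<close> costs at least \<open>r\<close>; by the first marginal such
  pairs have mass \<open>emeasure \<mu> A\<close>.\<close>

lemma wasserstein_uniform_measure_ge:
  assumes "Metric_space (space \<mu>) d" "prob_space \<mu>"
    and A[measurable]: "A \<in> sets \<mu>" and B[measurable]: "B \<in> sets \<mu>" "emeasure \<mu> B \<noteq> 0"
    and sep: "\<And>x y. x \<in> A \<Longrightarrow> y \<in> B \<Longrightarrow> r \<le> d x y"
  shows "ennreal r * emeasure \<mu> A \<le> wasserstein 1 d \<mu> (uniform_measure \<mu> B)"
  unfolding wasserstein_1
proof (rule INF_greatest)
  interpret prob_space \<mu> by fact
  interpret Metric_space "space \<mu>" d by fact
  let ?\<nu> = "uniform_measure \<mu> B"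
  fix \<pi> assume "\<pi> \<in> couplings \<mu> ?\<nu>"
  hence sets[measurable_cong]: "sets \<pi> = sets (\<mu> \<Otimes>\<^sub>M ?\<nu>)" and marg: "distr \<pi> \<mu> fst = \<mu>" "distr \<pi> ?\<nu> snd = ?\<nu>"
    by (auto simp: couplings_def)
  have [measurable]: "B \<in> sets ?\<nu>" by simp
  have "AE y in ?\<nu>. y \<in> B" by (intro AE_uniform_measureI) auto
  hence "AE z in \<pi>. snd z \<in> B"
    by (subst (asm) marg(2)[symmetric]) (subst (asm) AE_distr_iff, auto)
  hence "AE z in \<pi>. ennreal r * indicator A (fst z) \<le> (case z of (x, y) \<Rightarrow> ennreal (d x y powr 1))"
    by eventually_elim (auto simp: indicator_def case_prod_beta intro!: ennreal_leI sep)
  hence "(\<integral>\<^sup>+z. ennreal r * indicator A (fst z) \<partial>\<pi>) \<le> (\<integral>\<^sup>+(x, y). ennreal (d x y powr 1) \<partial>\<pi>)"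
    by (rule nn_integral_mono_AE)
  also have "(\<integral>\<^sup>+z. ennreal r * indicator A (fst z) \<partial>\<pi>) = (\<integral>\<^sup>+x. ennreal r * indicator A x \<partial>distr \<pi> \<mu> fst)"
    by (rule nn_integral_distr[symmetric]) auto
  also have "\<dots> = ennreal r * emeasure \<mu> A"
    unfolding marg by (simp add: nn_integral_cmult)
  finally show "ennreal r * emeasure \<mu> A \<le> (\<integral>\<^sup>+(x, y). ennreal (d x y powr 1) \<partial>\<pi>)" .
qed

lemma transport_inequality_tail:
  assumes "Metric_space (space \<mu>) d" "prob_space \<mu>" "transport_inequality 1 d C \<mu>"
    and A: "A \<in> sets \<mu>" and B: "B \<in> sets \<mu>"
    and sep: "\<And>x y. x \<in> A \<Longrightarrow> y \<in> B \<Longrightarrow> r \<le> d x y"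
    and half: "1 / 2 \<le> measure \<mu> A" and r: "0 \<le> r"
  shows "measure \<mu> B \<le> exp (- (r\<^sup>2 / (8 * C + 8)))" \<comment> \<open>not \<open>8 * C\<close>, which may be \<open>0\<close>\<close>
proof (cases "measure \<mu> B = 0")
  case False
  interpret prob_space \<mu> by fact
  have C: "0 \<le> C" using assms(3) by (simp add: transport_inequality_def)
  have B0: "emeasure \<mu> B \<noteq> 0" using False by (simp add: emeasure_eq_measure)
  \<comment> \<open>\<open>L\<close> is the entropy of \<open>\<mu>\<close> conditioned on
    \<open>B\<close>. Comparing both bounds on the distance gives
    \<open>r / 2 \<le> sqrt (2 * C * L)\<close>, hence \<open>r^2 \<le> 8 * C * L\<close>.\<close>
  define L where "L = - ln (measure \<mu> B)"
  have pos: "0 < measure \<mu> B" using False by (simp add: zero_less_measure_iff)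
  have L: "0 \<le> L" unfolding L_def using pos by simp
  have re: "relative_entropy (uniform_measure \<mu> B) \<mu> = ereal L"
    unfolding L_def by (rule relative_entropy_uniform_measure[OF assms(2) B B0])
  have "prob_space (uniform_measure \<mu> B)"
    using B0 by (rule prob_space_uniform_measure) simp
  hence "wasserstein 1 d \<mu> (uniform_measure \<mu> B) \<le> ennreal (sqrt (2 * C * L))"
    using assms(3) re unfolding transport_inequality_def
    by (auto dest!: spec[of _ "uniform_measure \<mu> B"])
  moreover have "ennreal r * emeasure \<mu> A \<le> wasserstein 1 d \<mu> (uniform_measure \<mu> B)"
    using assms(1,2) A B B0 sep by (rule wasserstein_uniform_measure_ge)
  ultimately have "ennreal (r * measure \<mu> A) \<le> ennreal (sqrt (2 * C * L))"
    using r by (simp add: emeasure_eq_measure ennreal_mult)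
  hence "r * measure \<mu> A \<le> sqrt (2 * C * L)"
    using C L by (subst (asm) ennreal_le_iff) auto
  moreover have "r * (1 / 2) \<le> r * measure \<mu> A"
    using r half by (rule mult_left_mono[rotated])
  ultimately have "r / 2 \<le> sqrt (2 * C * L)" by simp
  hence "(r / 2)\<^sup>2 \<le> 2 * C * L"
    using C L r by (metis divide_nonneg_pos mult_nonneg_nonneg power_mono real_sqrt_pow2 zero_le_numeral zero_less_numeral)
  hence "r\<^sup>2 \<le> (8 * C + 8) * L" using L by (simp add: power_divide algebra_simps)
  hence "r\<^sup>2 / (8 * C + 8) \<le> L" using C by (simp add: divide_le_eq mult.commute)
  hence "exp (- L) \<le> exp (- (r\<^sup>2 / (8 * C + 8)))" by simp
  thus ?thesis unfolding L_def using pos by simp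
qed simp

text \<open>The space is cut into layers by the integer part of \<open>F\<close>. The rate
  \<open>c / 8\<close> is small enough for the tail to beat the growth of the integrand despite the
  shift by \<open>m\<close>.\<close>

lemma nn_integral_exp_square_finite:
  fixes F :: "'a \<Rightarrow> real" and m :: nat
  assumes "prob_space M"
    and [measurable]: "F \<in> borel_measurable M" and F_nn: "\<And>x. x \<in> space M \<Longrightarrow> 0 \<le> F x"
    and c: "0 < c"
    and tail: "\<And>n::nat. m \<le> n \<Longrightarrow>
      measure M {x \<in> space M. real n \<le> F x} \<le> exp (- (c * (real n - real m)\<^sup>2))"
  shows "(\<integral>\<^sup>+x. ennreal (exp (c / 8 * (F x)\<^sup>2)) \<partial>M) < \<infinity>"
proof -
  interpret prob_space M by fact
  define B where "B = (\<lambda>n::nat. {x \<in> space M. real n \<le> F x})"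
  have [measurable]: "B n \<in> sets M" for n unfolding B_def by measurable
  \<comment> \<open>On the layer where \<open>F\<close> has integer part \<open>n\<close>,
    \<open>F\<close> is at most \<open>n + 1\<close>, and \<open>B n\<close> contains that
    layer.\<close>
  define t where "t = (\<lambda>n::nat. exp (c / 8 * (real n + 1)\<^sup>2) * measure M (B n))"
  have t_nn: "0 \<le> t n" for n by (simp add: t_def)
  \<comment> \<open>The threshold says \<open>(n + 1) / 2 \<le> n - m\<close>, so the tail exponent
    is at least \<open>c / 4 * (n + 1)^2\<close>, twice the growth exponent. The surplus
    \<open>c / 8 * (n + 1)^2\<close> is at least \<open>c / 8 * n\<close>, which gives a geometric
    bound.\<close>
  have t_le: "norm (t n) \<le> exp (- c / 8) ^ n" if n: "2 * m + 1 \<le> n" for n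
  proof -
    have "((real n + 1) / 2)\<^sup>2 \<le> (real n - real m)\<^sup>2"
      using n by (intro power_mono) auto
    hence "c * ((real n + 1)\<^sup>2 / 4) \<le> c * (real n - real m)\<^sup>2"
      using c by (simp add: power_divide)
    moreover have "real n * 1 \<le> (real n + 1)\<^sup>2" by (simp add: power2_eq_square algebra_simps)
    hence "c / 8 * real n \<le> c / 8 * (real n + 1)\<^sup>2" using c by (intro mult_left_mono) auto
    ultimately have "c / 8 * (real n + 1)\<^sup>2 + - (c * (real n - real m)\<^sup>2) \<le> real n * (- c / 8)"
      by (simp add: power2_eq_square field_simps)
    hence "exp (c / 8 * (real n + 1)\<^sup>2) * exp (- (c * (real n - real m)\<^sup>2)) \<le> exp (- c / 8) ^ n"
      by (simp flip: exp_add exp_of_nat_mult)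
    moreover have "t n \<le> exp (c / 8 * (real n + 1)\<^sup>2) * exp (- (c * (real n - real m)\<^sup>2))"
      unfolding t_def B_def using n by (intro mult_left_mono tail) auto
    ultimately show ?thesis using t_nn[of n] by simp
  qed
  have "summable t"
    by (rule summable_comparison_test'[where N = "2 * m + 1" and g = "\<lambda>n. exp (- c / 8) ^ n"])
       (use t_le c in \<open>auto intro!: summable_geometric\<close>)
  have le_suminf: "a n \<le> suminf a" for a :: "nat \<Rightarrow> ennreal" and n
    using sum_le_suminf[of a "{n}"] by simp
  have "(\<integral>\<^sup>+x. ennreal (exp (c / 8 * (F x)\<^sup>2)) \<partial>M) \<le>
      (\<integral>\<^sup>+x. (\<Sum>n. ennreal (exp (c / 8 * (real n + 1)\<^sup>2)) * indicator (B n) x) \<partial>M)"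
  proof (rule nn_integral_mono)
    fix x assume x: "x \<in> space M"
    \<comment> \<open>The summand with this index alone dominates the integrand at
      \<open>x\<close>.\<close>
    define n where "n = nat \<lfloor>F x\<rfloor>"
    have n: "real n \<le> F x" "F x \<le> real n + 1" using F_nn[OF x] by (auto simp: n_def)
    have "(F x)\<^sup>2 \<le> (real n + 1)\<^sup>2" using n F_nn[OF x] by (intro power_mono)
    hence "ennreal (exp (c / 8 * (F x)\<^sup>2)) \<le> ennreal (exp (c / 8 * (real n + 1)\<^sup>2)) * indicator (B n) x"
      using c n(1) x by (auto simp: B_def intro!: ennreal_leI)
    also have "\<dots> \<le> (\<Sum>n. ennreal (exp (c / 8 * (real n + 1)\<^sup>2)) * indicator (B n) x)"
      by (rule le_suminf)
    finally show "ennreal (exp (c / 8 * (F x)\<^sup>2)) \<le> (\<Sum>n. ennreal (exp (c / 8 * (real n + 1)\<^sup>2)) * indicator (B n) x)" .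
  qed
  also have "\<dots> = (\<Sum>n. ennreal (t n))"
    by (subst nn_integral_suminf) (simp_all add: nn_integral_cmult t_def emeasure_eq_measure ennreal_mult)
  also have "\<dots> = ennreal (suminf t)"
    using t_nn \<open>summable t\<close> by (rule suminf_ennreal2)
  finally show ?thesis by (auto simp: less_top[symmetric] top_unique)
qed

text \<open>The tail rate is \<open>c = 1 / (8 * C + 8)\<close>, the moment of \<open>F\<close> is
  finite at rate \<open>c / 8\<close>, and
  \<open>(F x + F y)^2 \<le> 2 * (F x)^2 + 2 * (F y)^2\<close> halves the rate for \<open>d\<close>:
  \<open>c / 16 = 1 / (128 * (C + 1))\<close>.\<close>

lemma gauss_moment_if_transport_inequality:
  assumes "Metric_space (space \<mu>) d" "prob_space \<mu>"
    and d_meas: "(\<lambda>(x, y). d x y) \<in> borel_measurable (\<mu> \<Otimes>\<^sub>M \<mu>)"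
    and T1: "transport_inequality 1 d C \<mu>"
  shows "gauss_moment d \<mu> (1 / (128 * (C + 1))) < \<infinity>"
proof -
  interpret prob_space \<mu> by fact
  interpret Metric_space "space \<mu>" d by fact
  obtain x0 where x0: "x0 \<in> space \<mu>" using not_empty by auto
  define F where "F = d x0"
  have [measurable]: "F \<in> borel_measurable \<mu>"
    unfolding F_def using measurable_compose[OF measurable_Pair1'[OF x0] d_meas] by simp
  have F_nn: "0 \<le> F x" for x by (simp add: F_def)
  \<comment> \<open>Balls around \<open>x0\<close> with natural radii exhaust the space, so one of
    them has mass above \<open>1 / 2\<close>. Its radius \<open>m\<close> is the shift in the tail
    bound.\<close>
  define A where "A = (\<lambda>m::nat. {x \<in> space \<mu>. F x \<le> real m})"
  have A_meas[measurable]: "A m \<in> sets \<mu>" for m unfolding A_def by measurable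
  have "(\<Union>m. A m) = space \<mu>"
    unfolding A_def using real_arch_simple by auto
  moreover have "(\<lambda>m. measure \<mu> (A m)) \<longlonglongrightarrow> measure \<mu> (\<Union>m. A m)"
    by (rule finite_Lim_measure_incseq) (auto simp: A_def incseq_def)
  ultimately have "(\<lambda>m. measure \<mu> (A m)) \<longlonglongrightarrow> 1" by (simp add: prob_space)
  hence "eventually (\<lambda>m. 1 / 2 < measure \<mu> (A m)) sequentially"
    by (rule order_tendstoD) simp
  then obtain m where m: "1 / 2 < measure \<mu> (A m)"
    by (auto simp: eventually_sequentially)
  define c where "c = 1 / (8 * C + 8)"
  have C: "0 \<le> C" using T1 by (simp add: transport_inequality_def)
  have c: "0 < c" using C by (simp add: c_def)
  have fin: "(\<integral>\<^sup>+x. ennreal (exp (c / 8 * (F x)\<^sup>2)) \<partial>\<mu>) < \<infinity>"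
  proof (rule nn_integral_exp_square_finite[OF assms(2), where m = m])
    fix n :: nat assume n: "m \<le> n"
    have "measure \<mu> {x \<in> space \<mu>. real n \<le> F x} \<le> exp (- ((real n - real m)\<^sup>2 / (8 * C + 8)))"
    proof (rule transport_inequality_tail[OF assms(1,2) T1 A_meas[of m]])
      fix x y assume "x \<in> A m" "y \<in> {x \<in> space \<mu>. real n \<le> F x}"
      thus "real n - real m \<le> d x y"
        using triangle[of x0 x y] x0 by (auto simp: A_def F_def)
    qed (use m n in auto)
    thus "measure \<mu> {x \<in> space \<mu>. real n \<le> F x} \<le> exp (- (c * (real n - real m)\<^sup>2))"
      by (simp add: c_def)
  qed (use c F_nn in auto)
  define J where "J = (\<integral>\<^sup>+x. ennreal (exp (c / 8 * (F x)\<^sup>2)) \<partial>\<mu>)"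
  have "gauss_moment d \<mu> (c / 16) \<le> (\<integral>\<^sup>+y. \<integral>\<^sup>+x. ennreal (exp (c / 8 * (F y)\<^sup>2)) * ennreal (exp (c / 8 * (F x)\<^sup>2)) \<partial>\<mu> \<partial>\<mu>)"
    unfolding gauss_moment_def
  proof (intro nn_integral_mono)
    fix x y assume xy: "x \<in> space \<mu>" "y \<in> space \<mu>"
    have "(d x y)\<^sup>2 \<le> (F x + F y)\<^sup>2"
      using triangle[of x x0 y] commute[of x x0] xy x0 by (intro power_mono) (auto simp: F_def)
    also have "\<dots> \<le> 2 * (F x)\<^sup>2 + 2 * (F y)\<^sup>2"
      using sum_squares_bound[of "F x" "F y"] by (simp add: power2_sum)
    finally have "c / 16 * (d x y)\<^sup>2 \<le> c / 16 * (2 * (F x)\<^sup>2 + 2 * (F y)\<^sup>2)"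
      using c by (intro mult_left_mono) auto
    hence "exp (c / 16 * (d x y)\<^sup>2) \<le> exp (c / 8 * (F y)\<^sup>2) * exp (c / 8 * (F x)\<^sup>2)"
      by (simp add: algebra_simps flip: exp_add)
    thus "ennreal (exp (c / 16 * (d x y)\<^sup>2)) \<le> ennreal (exp (c / 8 * (F y)\<^sup>2)) * ennreal (exp (c / 8 * (F x)\<^sup>2))"
      by (simp add: ennreal_mult[symmetric] ennreal_leI)
  qed
  also have "\<dots> = J * J"
    by (simp add: nn_integral_cmult nn_integral_multc J_def)
  also have "\<dots> < \<infinity>"
    using fin by (simp add: J_def ennreal_mult_less_top)
  finally show ?thesis by (simp add: c_def algebra_simps)
qed

section \<open>The explicit bound on the constant\<close>

lemma gauss_moment_ge_1:
  assumes "prob_space \<mu>" "0 < \<delta>"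
  shows "1 \<le> gauss_moment d \<mu> \<delta>"
proof -
  interpret prob_space \<mu> by fact
  have "1 = (\<integral>\<^sup>+y. \<integral>\<^sup>+x. 1 \<partial>\<mu> \<partial>\<mu>)" by (simp add: emeasure_space_1)
  also have "\<dots> \<le> gauss_moment d \<mu> \<delta>"
    unfolding gauss_moment_def using assms(2) by (intro nn_integral_mono) (simp add: one_le_exp_iff)
  finally show ?thesis .
qed

text \<open>The left-hand side is the term \<open>k = 1\<close> of the supremum, where the factorial
  quotient is \<open>1 / 2\<close>.\<close>

lemma T1_bound_ge:
  assumes "0 < \<delta>" "gauss_moment d \<mu> \<delta> < \<infinity>"
  shows "ennreal (enn2real (gauss_moment d \<mu> \<delta>) / \<delta>) \<le> T1_bound d \<mu> \<delta>"
proof -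
  define G where "G = enn2real (gauss_moment d \<mu> \<delta>)"
  have G: "gauss_moment d \<mu> \<delta> = ennreal G" and G0: "0 \<le> G"
    using assms(2) by (simp_all add: G_def)
  have "ennreal (G / \<delta>) = ennreal (2 / \<delta> * (1 / 2 * G))" by simp
  also have "\<dots> = ennreal (2 / \<delta>) * (ennreal (1 / 2) * ennreal G)"
    using assms(1) G0 by (subst ennreal_mult, simp, simp) (subst ennreal_mult, simp_all)
  also have "\<dots> = ennreal (2 / \<delta>) * (ennreal (((fact 1)\<^sup>2 / fact (2 * 1)) powr (1 / real 1)) *
      ennreal_powr (gauss_moment d \<mu> \<delta>) (1 / real 1))"
    using G0 by (simp add: ennreal_powr_def G)
  also have "\<dots> \<le> T1_bound d \<mu> \<delta>"
    unfolding T1_bound_def by (intro mult_left_mono SUP_upper) auto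
  finally show ?thesis by (simp add: G_def)
qed

text \<open>Every term of the supremum is at most \<open>G\<close>: the factorial factor is at most
  \<open>1\<close>, and roots of \<open>G\<close> do not exceed \<open>G\<close> because
  \<open>1 \<le> G\<close>.\<close>

lemma T1_bound_finite:
  assumes "prob_space \<mu>" "0 < \<delta>" "gauss_moment d \<mu> \<delta> < \<infinity>"
  shows "T1_bound d \<mu> \<delta> < \<infinity>"
proof -
  define G where "G = enn2real (gauss_moment d \<mu> \<delta>)"
  have G: "gauss_moment d \<mu> \<delta> = ennreal G"
    using assms(3) by (simp add: G_def)
  have G1: "1 \<le> G"
    using gauss_moment_ge_1[OF assms(1,2), of d] unfolding G by simp
  have "(SUP k\<in>{1::nat..}. ennreal (((fact k)\<^sup>2 / fact (2 * k)) powr (1 / real k)) *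
      ennreal_powr (gauss_moment d \<mu> \<delta>) (1 / real k)) \<le> ennreal G"
  proof (rule SUP_least)
    fix k :: nat assume k: "k \<in> {1..}"
    have "(fact k)\<^sup>2 \<le> (fact (2 * k) :: real)"
    proof -
      \<comment> \<open>The quotient \<open>fact (2 * k) / (fact k)^2\<close> is a central binomial
        coefficient, so divisibility gives the inequality.\<close>
      have "(fact k * fact k :: nat) \<le> fact (2 * k)"
        by (metis dvd_imp_le fact_fact_dvd_fact fact_gt_zero mult_2)
      hence "real (fact k * fact k) \<le> real (fact (2 * k))" by (rule of_nat_mono)
      thus ?thesis by (simp add: power2_eq_square)
    qed
    hence "((fact k)\<^sup>2 / fact (2 * k) :: real) powr (1 / real k) \<le> 1"
      by (intro powr_le1) auto
    moreover have "G powr (1 / real k) \<le> G powr 1"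
      using G1 k by (intro powr_mono) auto
    hence "G powr (1 / real k) \<le> G" using G1 by simp
    ultimately have "((fact k)\<^sup>2 / fact (2 * k)) powr (1 / real k) * G powr (1 / real k) \<le> 1 * G"
      by (intro mult_mono) auto
    thus "ennreal (((fact k)\<^sup>2 / fact (2 * k)) powr (1 / real k)) *
        ennreal_powr (gauss_moment d \<mu> \<delta>) (1 / real k) \<le> ennreal G"
      using G1 by (simp add: ennreal_powr_def G ennreal_mult[symmetric] ennreal_leI)
  qed
  hence "T1_bound d \<mu> \<delta> \<le> ennreal (2 / \<delta>) * ennreal G"
    unfolding T1_bound_def by (rule mult_left_mono) simp
  also have "\<dots> < \<infinity>" by (simp add: ennreal_mult_less_top)
  finally show ?thesis .
qed

theorem theorem2p3:
  fixes E :: "'a set" and d :: "'a \<Rightarrow> 'a \<Rightarrow> real" and \<mu> :: "'a measure"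
  assumes "Metric_space E d"
    and "prob_space \<mu>" and "space \<mu> = E"
    and "(\<lambda>(x, y). d x y) \<in> borel_measurable (\<mu> \<Otimes>\<^sub>M \<mu>)"
    and "separable_space (Metric_space.mtopology E d) \<Longrightarrow>
           sets \<mu> = sigma_sets E {U. openin (Metric_space.mtopology E d) U}"
  shows "((\<exists>C. transport_inequality 1 d C \<mu>) \<longleftrightarrow> (\<exists>\<delta>>0. gauss_moment d \<mu> \<delta> < \<infinity>)) \<and>
         (\<forall>\<delta>>0. gauss_moment d \<mu> \<delta> < \<infinity> \<longrightarrow>
            (\<exists>C. transport_inequality 1 d C \<mu> \<and> ennreal C \<le> T1_bound d \<mu> \<delta>) \<and>
            T1_bound d \<mu> \<delta> < \<infinity>)"
proof -
  have metric: "Metric_space (space \<mu>) d" using assms(1,3) by simp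
  note gauss = gauss_moment_if_transport_inequality[OF metric assms(2,4)]
  note transport = transport_inequality_if_gauss_moment[OF metric assms(2,4)]
  have "\<exists>\<delta>>0. gauss_moment d \<mu> \<delta> < \<infinity>" if "transport_inequality 1 d C \<mu>" for C
  proof (intro exI conjI)
    show "0 < 1 / (128 * (C + 1))"
      using that by (simp add: transport_inequality_def)
    show "gauss_moment d \<mu> (1 / (128 * (C + 1))) < \<infinity>"
      by (rule gauss[OF that])
  qed
  moreover have "\<exists>C. transport_inequality 1 d C \<mu> \<and> ennreal C \<le> T1_bound d \<mu> \<delta>"
    if "0 < \<delta>" "gauss_moment d \<mu> \<delta> < \<infinity>" for \<delta>
    \<comment> \<open>The witness is the moment divided by \<open>\<delta>\<close>.\<close>
    using transport[OF that] T1_bound_ge[OF that] by blast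
  ultimately show ?thesis
    using T1_bound_finite[OF assms(2)] by blast
qed

end
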